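(* Let $X$ be a doubly-laced Dynkin diagram of a symmetrizable Kac-Moody algebra with exactly two real root lengths. Let $Y$ be the Dynkin diagram of a linearly independent $\pi$-system of $X$. (1) If $X_{\mathrm{short}}$ (respectively $X_{\mathrm{long}}$) is of type $A_1$, then the finite diagram $C_3$ (respectively $B_3$) cannot occur as a subdiagram of $Y$. (2) If $X_{\mathrm{short}}$ is of type $A_2$, then the finite diagram $C_5$ and the hyperbolic diagram $HD_3^{(2)}$ cannot occur as subdiagrams of $Y$. (3) If $X_{\mathrm{long}}$ is of type $A_2$, then the finite diagram $B_5$ and the hyperbolic diagram $HC_2^{(1)}$ cannot occur as subdiagrams of $Y$.
   Context: For the Dynkin diagram $X$ of a symmetrizable Kac-Moody algebra with simple roots $\alpha_i$ ($i\in X$), fix a standard invariant form and the resulting root lengths. $X_{\mathrm{short}}$ is the subdiagram formed by the simple roots of shortest length (those $p\in X$ with $|\alpha_p|=\min_{i\in X}|\alpha_i|$) and $X_{\mathrm{long}}$ is the subdiagram formed by the simple roots of longest length. Subdiagrams are those induced on subsets of vertices. $X$ is doubly-laced if every edge of $X$ is either a single edge or a double edge with an arrow pointing in one direction (i.e. $\{a_{ij},a_{ji}\}=\{-1,-2\}$), and $X$ contains at least one double edge. Arrows point toward the shorter root. A $\pi$-system of $X$ is a finite set of distinct real roots $\{\beta_i\}_{i=1}^m$ such that $\beta_i-\beta_j$ is not a root for any $i\ne j$; its Dynkin diagram is that of the generalized Cartan matrix $[\langle\beta_i^\vee,\beta_j\rangle]_{i,j}$, where $\beta^\vee$ denotes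 the coroot of a real root $\beta$. Conventions: $B_n$ has $n-1$ long and one short simple root; $C_n$ has $n-1$ short and one long simple root. $HD_3^{(2)}$ is the linear diagram on vertices $1,2,3,4$ with a single edge between $1,2$, a double edge between $2,3$ with arrow pointing to $2$, and a double edge between $3,4$ with arrow pointing to $4$ (so $1,2,4$ are short and $3$ is long). $HC_2^{(1)}$ is the linear diagram on vertices $1,2,3,4$ with a single edge between $1,2$, a double edge between $2,3$ with arrow pointing to $3$, and a double edge between $3,4$ with arrow pointing to $3$ (so $1,2,4$ are long and $3$ is short). *)

theory Defs
  imports "HOL-Analysis.Analysis" "HOL-Library.Function_Algebras"
begin

section \<open>Generalized Cartan matrices and Dynkin diagrams\<close>

text \<open>
  The vertices of the diagram \<open>X\<close> are the elements of a finite type; \<open>A i j\<close> is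
  \<open>a\<^sub>i\<^sub>j = \<langle>\<alpha>\<^sub>i\<^sup>\<or>, \<alpha>\<^sub>j\<rangle>\<close>.  A Dynkin diagram is represented by its generalized Cartan
  matrix restricted to its vertex set, so that induced subdiagrams are restrictions to
  subsets of vertices.
\<close>

definition gen_cartan_matrix :: "('i \<Rightarrow> 'i \<Rightarrow> int) \<Rightarrow> bool" where
  "gen_cartan_matrix A \<longleftrightarrow>
     (\<forall>i. A i i = 2) \<and>
     (\<forall>i j. i \<noteq> j \<longrightarrow> A i j \<le> 0) \<and>
     (\<forall>i j. A i j = 0 \<longrightarrow> A j i = 0)"

text \<open>\<open>A = diag(\<epsilon>) B\<close> with \<open>B\<close> symmetric.\<close>

definition symmetrized_by :: "('i \<Rightarrow> 'i \<Rightarrow> int) \<Rightarrow> ('i \<Rightarrow> rat) \<Rightarrow> bool" where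
  "symmetrized_by A \<epsilon> \<longleftrightarrow>
     (\<forall>i. \<epsilon> i > 0) \<and> (\<forall>i j. of_int (A i j) / \<epsilon> i = of_int (A j i) / \<epsilon> j)"

definition symmetrizable :: "('i \<Rightarrow> 'i \<Rightarrow> int) \<Rightarrow> bool" where
  "symmetrizable A \<longleftrightarrow> (\<exists>\<epsilon>. symmetrized_by A \<epsilon>)"

definition doubly_laced :: "('i \<Rightarrow> 'i \<Rightarrow> int) \<Rightarrow> bool" where
  "doubly_laced A \<longleftrightarrow>
     (\<forall>i j. i \<noteq> j \<and> A i j \<noteq> 0 \<longrightarrow>
        (A i j = -1 \<and> A j i = -1) \<or> {A i j, A j i} = {-1, -2}) \<and>
     (\<exists>i j. {A i j, A j i} = {-1, -2})"

text \<open>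
  A linear diagram on vertices \<open>1, \<dots>, length bs + 1\<close> is given by the list of its edges, the
  \<open>k\<close>-th one joining \<open>k\<close> and \<open>k + 1\<close>.  \<open>Bond_Right\<close> is a double edge with arrow pointing to
  \<open>k + 1\<close>, \<open>Bond_Left\<close> one with arrow pointing to \<open>k\<close>.  The arrow points to the shorter root,
  so an arrow from \<open>i\<close> to \<open>j\<close> means \<open>a\<^sub>i\<^sub>j = -1\<close> and \<open>a\<^sub>j\<^sub>i = -2\<close>.
\<close>

datatype bond = Bond_Single | Bond_Right | Bond_Left

definition linear_gcm :: "bond list \<Rightarrow> nat \<Rightarrow> nat \<Rightarrow> int" where
  "linear_gcm bs i j =
     (if i = j then 2
      else if j = i + 1 then (if bs ! (i - 1) = Bond_Left then -2 else -1)
      else if i = j + 1 then (if bs ! (j - 1) = Bond_Right then -2 else -1)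
      else 0)"

definition diagram_A :: "nat \<Rightarrow> bond list" where
  "diagram_A n = replicate (n - 1) Bond_Single"

definition diagram_B :: "nat \<Rightarrow> bond list" where
  "diagram_B n = replicate (n - 2) Bond_Single @ [Bond_Right]"

definition diagram_C :: "nat \<Rightarrow> bond list" where
  "diagram_C n = replicate (n - 2) Bond_Single @ [Bond_Left]"

definition diagram_HD3_2 :: "bond list" where
  "diagram_HD3_2 = [Bond_Single, Bond_Left, Bond_Right]"

definition diagram_HC2_1 :: "bond list" where
  "diagram_HC2_1 = [Bond_Single, Bond_Right, Bond_Left]"

text \<open>
  Isomorphism of the diagram with vertex set \<open>V\<close> and matrix \<open>M\<close> with a linear diagram.  The
  entries of \<open>M\<close> may lie in any ring because the Cartan matrix of a \<open>\<pi>\<close>-system below consists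
  of values of complex linear functionals.
\<close>

definition diagram_of_type :: "'v set \<Rightarrow> ('v \<Rightarrow> 'v \<Rightarrow> 'k::ring_1) \<Rightarrow> bond list \<Rightarrow> bool" where
  "diagram_of_type V M bs \<longleftrightarrow>
     (\<exists>f. bij_betw f V {1..length bs + 1} \<and>
          (\<forall>u\<in>V. \<forall>v\<in>V. M u v = of_int (linear_gcm bs (f u) (f v))))"

definition occurs_as_subdiagram :: "bond list \<Rightarrow> 'v set \<Rightarrow> ('v \<Rightarrow> 'v \<Rightarrow> 'k::ring_1) \<Rightarrow> bool" where
  "occurs_as_subdiagram bs V M \<longleftrightarrow> (\<exists>W\<subseteq>V. diagram_of_type W M bs)"


section \<open>Kac-Moody algebras\<close>

locale lie_algebra = vector_space scale
  for scale :: "complex \<Rightarrow> 'g::ab_group_add \<Rightarrow> 'g" +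
  fixes br :: "'g \<Rightarrow> 'g \<Rightarrow> 'g"
  assumes bracket_linear_left: "Vector_Spaces.linear scale scale (\<lambda>x. br x y)"
    and bracket_linear_right: "Vector_Spaces.linear scale scale (br x)"
    and bracket_self: "br x x = 0"
    and jacobi: "br x (br y z) + br y (br z x) + br z (br x y) = 0"
begin

definition lie_subalgebra :: "'g set \<Rightarrow> bool" where
  "lie_subalgebra S \<longleftrightarrow> subspace S \<and> (\<forall>x\<in>S. \<forall>y\<in>S. br x y \<in> S)"

definition lie_ideal :: "'g set \<Rightarrow> bool" where
  "lie_ideal S \<longleftrightarrow> subspace S \<and> (\<forall>x. \<forall>y\<in>S. br x y \<in> S)"

end

text \<open>
  The Cartan subalgebra is a vector space \<open>'h\<close> of its own together with an injection
  \<open>cartan\<close> into the algebra, and the dual \<open>\<hh>\<^sup>*\<close> consists of the linear functionals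
  \<open>'h \<Rightarrow> complex\<close>, with pointwise operations.
\<close>

record ('g, 'h, 'i) kac_moody =
  scale_g :: "complex \<Rightarrow> 'g \<Rightarrow> 'g"
  bracket :: "'g \<Rightarrow> 'g \<Rightarrow> 'g"
  scale_h :: "complex \<Rightarrow> 'h \<Rightarrow> 'h"
  cartan :: "'h \<Rightarrow> 'g"
  gcm :: "'i \<Rightarrow> 'i \<Rightarrow> int"
  simple_root :: "'i \<Rightarrow> 'h \<Rightarrow> complex"
  simple_coroot :: "'i \<Rightarrow> 'h"
  gen_e :: "'i \<Rightarrow> 'g"
  gen_f :: "'i \<Rightarrow> 'g"

definition scale_dual :: "complex \<Rightarrow> ('h \<Rightarrow> complex) \<Rightarrow> 'h \<Rightarrow> complex" where
  "scale_dual c \<phi> = (\<lambda>h. c * \<phi> h)"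

text \<open>
  Kac's characterization of \<open>\<gg>(A)\<close>: the simple roots and coroots form a realization of \<open>A\<close>
  (linearly independent, of the minimal dimension \<open>2n - rank A\<close>), the Chevalley generators
  satisfy the defining relations and generate together with \<open>\<hh>\<close>, and no nonzero ideal meets
  \<open>\<hh>\<close> trivially.
\<close>

locale kac_moody_algebra =
  fixes G :: "('g::ab_group_add, 'h::ab_group_add, 'i::finite) kac_moody"
  assumes gcm: "gen_cartan_matrix (gcm G)"
    and lie: "lie_algebra (scale_g G) (bracket G)"
    and vector_space_h: "vector_space (scale_h G)"
    and finite_dim_h: "\<exists>B. finite B \<and> module.span (scale_h G) B = UNIV"
    and dim_h: "vector_space.dim (scale_h G) UNIV +
                  rank (\<chi> i j. complex_of_int (gcm G i j)) = 2 * CARD('i)"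
    and simple_root_linear: "Vector_Spaces.linear (scale_h G) (*) (simple_root G i)"
    and simple_root_indep:
      "inj (simple_root G)" "\<not> module.dependent scale_dual (range (simple_root G))"
    and simple_coroot_indep:
      "inj (simple_coroot G)" "\<not> module.dependent (scale_h G) (range (simple_coroot G))"
    and pairing: "simple_root G j (simple_coroot G i) = of_int (gcm G i j)"
    and cartan_linear: "Vector_Spaces.linear (scale_h G) (scale_g G) (cartan G)"
    and cartan_inj: "inj (cartan G)"
    and bracket_h_h: "bracket G (cartan G h) (cartan G h') = 0"
    and bracket_e_f:
      "bracket G (gen_e G i) (gen_f G j) = (if i = j then cartan G (simple_coroot G i) else 0)"
    and bracket_h_e:
      "bracket G (cartan G h) (gen_e G i) = scale_g G (simple_root G i h) (gen_e G i)"
    and bracket_h_f: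
      "bracket G (cartan G h) (gen_f G i) = scale_g G (- simple_root G i h) (gen_f G i)"
    and generated:
      "\<lbrakk>lie_algebra.lie_subalgebra (scale_g G) (bracket G) S;
        range (cartan G) \<union> range (gen_e G) \<union> range (gen_f G) \<subseteq> S\<rbrakk> \<Longrightarrow> S = UNIV"
    and no_ideals:
      "\<lbrakk>lie_algebra.lie_ideal (scale_g G) (bracket G) S; S \<inter> range (cartan G) = {0}\<rbrakk>
         \<Longrightarrow> S = {0}"


section \<open>Roots and coroots\<close>

definition root_space ::
    "('g::zero, 'h, 'i) kac_moody \<Rightarrow> ('h \<Rightarrow> complex) \<Rightarrow> 'g set" where
  "root_space G \<beta> = {x. \<forall>h. bracket G (cartan G h) x = scale_g G (\<beta> h) x}"

definition is_root ::
    "('g::ab_group_add, 'h::ab_group_add, 'i) kac_moody \<Rightarrow> ('h \<Rightarrow> complex) \<Rightarrow> bool" where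
  "is_root G \<beta> \<longleftrightarrow>
     Vector_Spaces.linear (scale_h G) (*) \<beta> \<and> \<beta> \<noteq> 0 \<and> root_space G \<beta> \<noteq> {0}"

text \<open>The simple reflection \<open>s\<^sub>i\<close> on \<open>\<hh>\<^sup>*\<close> and its contragredient action on \<open>\<hh>\<close>.\<close>

definition refl ::
    "('g, 'h, 'i) kac_moody \<Rightarrow> 'i \<Rightarrow> ('h \<Rightarrow> complex) \<Rightarrow> 'h \<Rightarrow> complex" where
  "refl G i \<phi> = (\<lambda>h. \<phi> h - \<phi> (simple_coroot G i) * simple_root G i h)"

definition corefl ::
    "('g, 'h::ab_group_add, 'i) kac_moody \<Rightarrow> 'i \<Rightarrow> 'h \<Rightarrow> 'h" where
  "corefl G i h = h - scale_h G (simple_root G i h) (simple_coroot G i)"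

text \<open>Elements of the Weyl group are written as words in the simple reflections.\<close>

definition weyl_act ::
    "('g, 'h, 'i) kac_moody \<Rightarrow> 'i list \<Rightarrow> ('h \<Rightarrow> complex) \<Rightarrow> 'h \<Rightarrow> complex" where
  "weyl_act G w = foldr (refl G) w"

definition weyl_coact ::
    "('g, 'h::ab_group_add, 'i) kac_moody \<Rightarrow> 'i list \<Rightarrow> 'h \<Rightarrow> 'h" where
  "weyl_coact G w = foldr (corefl G) w"

definition real_roots :: "('g, 'h, 'i) kac_moody \<Rightarrow> ('h \<Rightarrow> complex) set" where
  "real_roots G = {weyl_act G w (simple_root G i) | w i. True}"

text \<open>
  The coroot of \<open>\<beta> = w \<alpha>\<^sub>i\<close> is \<open>w \<alpha>\<^sub>i\<^sup>\<or>\<close>, which does not depend on the choice of \<open>w\<close> and \<open>i\<close>.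
\<close>

definition coroot ::
    "('g, 'h::ab_group_add, 'i) kac_moody \<Rightarrow> ('h \<Rightarrow> complex) \<Rightarrow> 'h" where
  "coroot G \<beta> = (THE h. \<exists>w i. \<beta> = weyl_act G w (simple_root G i) \<and>
                              h = weyl_coact G w (simple_coroot G i))"


section \<open>Standard invariant forms and root lengths\<close>

text \<open>
  Kac's standard invariant form on the algebra, attached to a decomposition
  \<open>A = diag(\<epsilon>) B\<close> with positive rational \<open>\<epsilon>\<^sub>i\<close> and to a complement \<open>U\<close> of the span of the
  simple coroots in \<open>\<hh>\<close>.
\<close>

definition standard_invariant_form ::
    "('g::ab_group_add, 'h::ab_group_add, 'i) kac_moody \<Rightarrow> ('g \<Rightarrow> 'g \<Rightarrow> complex) \<Rightarrow> bool" where
  "standard_invariant_form G K \<longleftrightarrow>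
     (\<forall>x. Vector_Spaces.linear (scale_g G) (*) (K x)) \<and>
     (\<forall>x y. K x y = K y x) \<and>
     (\<forall>x y z. K (bracket G x y) z = K x (bracket G y z)) \<and>
     (\<exists>\<epsilon> U. symmetrized_by (gcm G) \<epsilon> \<and>
        module.subspace (scale_h G) U \<and>
        U \<inter> module.span (scale_h G) (range (simple_coroot G)) = {0} \<and>
        (\<forall>h. \<exists>u\<in>U. h - u \<in> module.span (scale_h G) (range (simple_coroot G))) \<and>
        (\<forall>i h. K (cartan G (simple_coroot G i)) (cartan G h) = of_rat (\<epsilon> i) * simple_root G i h) \<and>
        (\<forall>u\<in>U. \<forall>v\<in>U. K (cartan G u) (cartan G v) = 0))"

text \<open>
  The restriction of such a form to \<open>\<hh>\<close> is nondegenerate; \<open>dual_form\<close> is its transport to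
  \<open>\<hh>\<^sup>*\<close> along the isomorphism \<open>form_nu\<close>.
\<close>

definition form_nu ::
    "('g, 'h, 'i) kac_moody \<Rightarrow> ('g \<Rightarrow> 'g \<Rightarrow> complex) \<Rightarrow> 'h \<Rightarrow> 'h \<Rightarrow> complex" where
  "form_nu G K h = (\<lambda>h'. K (cartan G h) (cartan G h'))"

definition dual_form ::
    "('g, 'h, 'i) kac_moody \<Rightarrow> ('g \<Rightarrow> 'g \<Rightarrow> complex) \<Rightarrow>
     ('h \<Rightarrow> complex) \<Rightarrow> ('h \<Rightarrow> complex) \<Rightarrow> complex" where
  "dual_form G K \<phi> \<psi> = K (cartan G (inv (form_nu G K) \<phi>)) (cartan G (inv (form_nu G K) \<psi>))"

text \<open>For a real root \<open>\<beta>\<close> the number \<open>(\<beta> | \<beta>)\<close> is real and positive.\<close>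

definition root_length ::
    "('g, 'h, 'i) kac_moody \<Rightarrow> ('g \<Rightarrow> 'g \<Rightarrow> complex) \<Rightarrow> ('h \<Rightarrow> complex) \<Rightarrow> real" where
  "root_length G K \<beta> = sqrt (Re (dual_form G K \<beta> \<beta>))"

definition X_short :: "('g, 'h, 'i::finite) kac_moody \<Rightarrow> ('g \<Rightarrow> 'g \<Rightarrow> complex) \<Rightarrow> 'i set" where
  "X_short G K = {p. root_length G K (simple_root G p) =
                       Min (range (\<lambda>i. root_length G K (simple_root G i)))}"

definition X_long :: "('g, 'h, 'i::finite) kac_moody \<Rightarrow> ('g \<Rightarrow> 'g \<Rightarrow> complex) \<Rightarrow> 'i set" where
  "X_long G K = {p. root_length G K (simple_root G p) =
                      Max (range (\<lambda>i. root_length G K (simple_root G i)))}"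


section \<open>\<open>\<pi>\<close>-systems\<close>

definition pi_system ::
    "('g::ab_group_add, 'h::ab_group_add, 'i) kac_moody \<Rightarrow> ('h \<Rightarrow> complex) set \<Rightarrow> bool" where
  "pi_system G S \<longleftrightarrow> finite S \<and> S \<subseteq> real_roots G \<and>
     (\<forall>\<beta>\<in>S. \<forall>\<gamma>\<in>S. \<beta> \<noteq> \<gamma> \<longrightarrow> \<not> is_root G (\<beta> - \<gamma>))"

text \<open>The Cartan matrix \<open>\<langle>\<beta>\<^sup>\<or>, \<gamma>\<rangle>\<close> of a \<open>\<pi>\<close>-system, indexed by its elements.\<close>

definition pi_matrix ::
    "('g, 'h::ab_group_add, 'i) kac_moody \<Rightarrow>
     ('h \<Rightarrow> complex) \<Rightarrow> ('h \<Rightarrow> complex) \<Rightarrow> complex" where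
  "pi_matrix G \<beta> \<gamma> = \<gamma> (coroot G \<beta>)"

end

theory Submission
  imports Defs
begin

text \<open>
  Real roots have integer coordinates \<open>x\<close> in the simple roots, their coroots have integer
  coordinates \<open>x'\<close> in the simple coroots, and \<open>\<epsilon>\<^sub>j x'\<^sub>j = \<epsilon>\<^sub>i x\<^sub>j\<close> for a root in the Weyl orbit of
  \<open>\<alpha>\<^sub>i\<close>. If \<open>\<beta>\<close> is short and \<open>S\<close> is the set of short simple roots, then \<open>x'\<^sub>j\<close> is even for
  \<open>j \<notin> S\<close>, and \<open>a\<^sub>j\<^sub>k\<close> is even for \<open>j \<in> S\<close>, \<open>k \<notin> S\<close>; so modulo 2 the number
  \<open>\<langle>\<beta>\<^sup>\<or>, \<gamma>\<rangle>\<close> only depends on the coordinates in \<open>S\<close>. If \<open>S\<close> is of type \<open>A\<^sub>1\<close> it is even, so two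
  short roots never form an \<open>A\<^sub>2\<close>, which \<open>C\<^sub>3\<close> contains. If \<open>S\<close> is of type \<open>A\<^sub>2\<close> it is the
  symplectic form on \<open>F\<^sub>2\<^sup>2\<close>, and short roots have nonzero image there: four short roots in
  a chain would span a space of rank 4, which excludes \<open>C\<^sub>5\<close>, and in \<open>HD\<^sub>3\<^sup>(\<^sup>2\<^sup>)\<close> the vertex 4 would be
  orthogonal to the basis given by the vertices 1 and 2. The claims about long roots are the
  same claims for the transposed matrix, with roots and coroots exchanged.
\<close>

section \<open>Coordinates of real roots\<close>

definition coord_refl :: "('i::finite \<Rightarrow> 'i \<Rightarrow> int) \<Rightarrow> 'i \<Rightarrow> ('i \<Rightarrow> int) \<Rightarrow> 'i \<Rightarrow> int" where
  "coord_refl A i x = x(i := x i - (\<Sum>k\<in>UNIV. A i k * x k))"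

text \<open>The pair \<open>(w, i)\<close> stands for the real root \<open>w \<alpha>\<^sub>i\<close>.\<close>

definition root_coords :: "('i::finite \<Rightarrow> 'i \<Rightarrow> int) \<Rightarrow> 'i list \<times> 'i \<Rightarrow> 'i \<Rightarrow> int" where
  "root_coords A r = foldr (coord_refl A) (fst r) (\<lambda>j. of_bool (j = snd r))"

text \<open>Real coroots behave as real roots of the transposed matrix, so
  \<open>root_coords (dual_gcm A) r\<close> holds the coordinates of the coroot of
  \<open>r\<close>.\<close>

definition dual_gcm :: "('i \<Rightarrow> 'i \<Rightarrow> int) \<Rightarrow> 'i \<Rightarrow> 'i \<Rightarrow> int" where
  "dual_gcm A = (\<lambda>i j. A j i)"

text \<open>The value of the coroot of \<open>r\<close> on the root \<open>s\<close>. Indexing by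
  words keeps the question whether a coroot depends on the chosen word out of the coordinate
  computations.\<close>

definition coord_pairing :: "('i::finite \<Rightarrow> 'i \<Rightarrow> int) \<Rightarrow> 'i list \<times> 'i \<Rightarrow> 'i list \<times> 'i \<Rightarrow> int" where
  "coord_pairing A r s =
     (\<Sum>j\<in>UNIV. \<Sum>k\<in>UNIV. root_coords (dual_gcm A) r j * A j k * root_coords A s k)"

definition realizes :: "('i::finite \<Rightarrow> 'i \<Rightarrow> int) \<Rightarrow> bond list \<Rightarrow> (nat \<Rightarrow> 'i list \<times> 'i) \<Rightarrow> bool" where
  "realizes A bs r \<longleftrightarrow> (\<forall>m\<in>{1..length bs + 1}. \<forall>n\<in>{1..length bs + 1}.
     coord_pairing A (r m) (r n) = linear_gcm bs m n)"

lemma root_coords_Nil [simp]: "root_coords A ([], i) = (\<lambda>j. of_bool (j = i))"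
  by (simp add: root_coords_def)

lemma root_coords_Cons [simp]: "root_coords A (k # w, i) = coord_refl A k (root_coords A (w, i))"
  by (simp add: root_coords_def)

lemma dual_gcm_dual_gcm [simp]: "dual_gcm (dual_gcm A) = A"
  by (simp add: dual_gcm_def)

text \<open>Transposing exchanges roots and coroots, which only changes the order of summation. This
  carries statements on short roots over to long ones.\<close>

lemma coord_pairing_dual: "coord_pairing (dual_gcm A) r s = coord_pairing A s r"
proof -
  have "coord_pairing (dual_gcm A) r s =
    (\<Sum>j\<in>UNIV. \<Sum>k\<in>UNIV. root_coords (dual_gcm A) s k * A k j * root_coords A r j)"
    unfolding coord_pairing_def dual_gcm_dual_gcm by (simp add: dual_gcm_def mult_ac)
  also have "\<dots> = coord_pairing A s r"
    unfolding coord_pairing_def by (rule sum.swap)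
  finally show ?thesis .
qed

lemma symmetrized_by_dual:
  assumes "symmetrized_by A \<epsilon>"
  shows "symmetrized_by (dual_gcm A) (\<lambda>i. 1 / \<epsilon> i)"
  unfolding symmetrized_by_def
proof (intro conjI allI)
  fix i j
  have "\<epsilon> i > 0" "\<epsilon> j > 0" "of_int (A i j) / \<epsilon> i = of_int (A j i) / \<epsilon> j"
    using assms by (auto simp: symmetrized_by_def)
  then show "1 / \<epsilon> i > 0"
    and "of_int (dual_gcm A i j) / (1 / \<epsilon> i) = of_int (dual_gcm A j i) / (1 / \<epsilon> j)"
    by (auto simp: dual_gcm_def field_simps)
qed

text \<open>Induction on the word: both reflections change only coordinate \<open>k\<close>, and
  \<open>\<epsilon> k * A l k = \<epsilon> l * A k l\<close> matches the two subtracted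
  sums.\<close>

lemma coroot_coords:
  assumes "symmetrized_by A \<epsilon>"
  shows "\<epsilon> j * of_int (root_coords (dual_gcm A) r j) = \<epsilon> (snd r) * of_int (root_coords A r j)"
proof -
  obtain w i where r: "r = (w, i)" by (cases r)
  have pos: "\<epsilon> k > 0" for k using assms by (auto simp: symmetrized_by_def)
  have sym: "\<epsilon> k * of_int (A j k) = of_int (A k j) * \<epsilon> j" for j k
  proof -
    have "of_int (A j k) / \<epsilon> j = of_int (A k j) / \<epsilon> k"
      using assms by (auto simp: symmetrized_by_def)
    then show ?thesis using pos[of j] pos[of k] by (simp add: field_simps)
  qed
  have "\<epsilon> j * of_int (root_coords (dual_gcm A) (w, i) j) = \<epsilon> i * of_int (root_coords A (w, i) j)"
  proof (induction w arbitrary: j)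
    case Nil
    then show ?case by simp
  next
    case (Cons k w)
    let ?x = "root_coords A (w, i)" and ?y = "root_coords (dual_gcm A) (w, i)"
    have "\<epsilon> k * of_int (\<Sum>l\<in>UNIV. A l k * ?y l) = (\<Sum>l\<in>UNIV. of_int (A k l) * (\<epsilon> l * of_int (?y l)))"
      unfolding of_int_sum sum_distrib_left
      by (rule sum.cong) (simp_all add: sym flip: mult.assoc)
    also have "\<dots> = \<epsilon> i * of_int (\<Sum>l\<in>UNIV. A k l * ?x l)"
      unfolding Cons of_int_sum sum_distrib_left by (simp add: mult_ac)
    finally show ?case using Cons
      by (simp add: coord_refl_def dual_gcm_def algebra_simps)
  qed
  then show ?thesis by (simp add: r)
qed

text \<open>Both sides are the symmetric form on the root lattice with matrix
  \<open>A j k / \<epsilon> j\<close>; substituting the coroot coordinates shows it.\<close>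

lemma coord_pairing_sym:
  assumes "symmetrized_by A \<epsilon>"
  shows "of_int (coord_pairing A r s) / \<epsilon> (snd r) = of_int (coord_pairing A s r) / \<epsilon> (snd s)"
proof -
  have pos: "\<epsilon> k > 0" for k using assms by (auto simp: symmetrized_by_def)
  have sym: "of_int (A j k) / \<epsilon> j = of_int (A k j) / \<epsilon> k" for j k
    using assms by (auto simp: symmetrized_by_def)
  have co: "of_int (root_coords (dual_gcm A) r j) = \<epsilon> (snd r) * of_int (root_coords A r j) / \<epsilon> j" for r j
    using coroot_coords[OF assms, of j r] pos[of j] by (simp add: field_simps)
  have expand: "of_int (coord_pairing A r s) / \<epsilon> (snd r) =
    (\<Sum>j\<in>UNIV. \<Sum>k\<in>UNIV. of_int (root_coords A r j) * (of_int (A j k) / \<epsilon> j) * of_int (root_coords A s k))"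
    for r s
  proof -
    have "\<epsilon> (snd r) \<noteq> 0" using pos[of "snd r"] by simp
    then show ?thesis
      unfolding coord_pairing_def of_int_sum of_int_mult co sum_divide_distrib
      by (intro sum.cong refl) (simp add: field_simps)
  qed
  show ?thesis
    unfolding expand
    by (subst sum.swap, intro sum.cong refl, subst sym, simp add: mult_ac)
qed

text \<open>By \<open>coord_pairing_sym\<close> the weights are in the ratio of the two entries: the
  root whose coroot takes the value \<open>-2\<close> is the shorter one and has twice the
  weight.\<close>

lemma double_bond_ratio:
  assumes "symmetrized_by A \<epsilon>" "coord_pairing A r s = -2" "coord_pairing A s r = -1"
  shows "\<epsilon> (snd r) = 2 * \<epsilon> (snd s)"
proof -
  have "\<epsilon> (snd r) > 0" "\<epsilon> (snd s) > 0" using assms by (auto simp: symmetrized_by_def)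
  then show ?thesis
    using coord_pairing_sym[OF assms(1), of r s] assms(2,3) by (simp add: field_simps)
qed

lemma single_bond_ratio:
  assumes "symmetrized_by A \<epsilon>" "coord_pairing A r s = -1" "coord_pairing A s r = -1"
  shows "\<epsilon> (snd r) = \<epsilon> (snd s)"
proof -
  have "\<epsilon> (snd r) > 0" "\<epsilon> (snd s) > 0" using assms by (auto simp: symmetrized_by_def)
  then show ?thesis
    using coord_pairing_sym[OF assms(1), of r s] assms(2,3) by (simp add: field_simps)
qed

section \<open>Reduction modulo 2\<close>

text \<open>Short roots have the large weight, because \<open>(\<alpha>\<^sub>i|\<alpha>\<^sub>i) = 2 / \<epsilon>\<^sub>i\<close>.\<close>

locale short_class =
  fixes A :: "'i::finite \<Rightarrow> 'i \<Rightarrow> int" and \<epsilon> :: "'i \<Rightarrow> rat" and S :: "'i set" and e :: rat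
  assumes diag: "A i i = 2"
    and sym: "symmetrized_by A \<epsilon>"
    and e_pos: "e > 0"
    and weight: "\<epsilon> i = (if i \<in> S then 2 * e else e)"
begin

lemma even_short_long:
  assumes "j \<in> S" "k \<notin> S"
  shows "even (A j k)"
proof -
  have "of_int (A j k) / \<epsilon> j = of_int (A k j) / \<epsilon> k"
    using sym by (auto simp: symmetrized_by_def)
  then have "of_int (A j k) = (of_int (2 * A k j) :: rat)"
    using e_pos assms by (simp add: weight field_simps)
  then have "A j k = 2 * A k j" by (simp only: of_int_eq_iff)
  then show ?thesis by simp
qed

lemma coroot_coords_short:
  assumes "snd r \<in> S"
  shows "root_coords (dual_gcm A) r j = (if j \<in> S then 1 else 2) * root_coords A r j"
proof -
  have "(of_int (root_coords (dual_gcm A) r j) :: rat) =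
      of_int ((if j \<in> S then 1 else 2) * root_coords A r j)"
    using coroot_coords[OF sym, of j r] e_pos assms by (auto simp: weight)
  then show ?thesis by (simp only: of_int_eq_iff)
qed

text \<open>Terms with \<open>j\<close> outside \<open>S\<close> are even because coroot coordinates
  double there, terms with only \<open>k\<close> outside because \<open>A j k\<close> is even. On
  \<open>S\<close> the coroot and root coordinates agree.\<close>

lemma coord_pairing_mod2:
  assumes "snd r \<in> S"
  shows "even (coord_pairing A r s - (\<Sum>j\<in>S. \<Sum>k\<in>S. root_coords A r j * A j k * root_coords A s k))"
proof -
  let ?t = "\<lambda>j k. root_coords (dual_gcm A) r j * A j k * root_coords A s k"
  have split: "sum f UNIV = sum f S + sum f (- S)" for f :: "'i \<Rightarrow> int"
    using sum.subset_diff[of S UNIV f] by (simp add: Compl_eq_Diff_UNIV)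
  have "even (\<Sum>j\<in>-S. \<Sum>k\<in>UNIV. ?t j k)"
    by (intro dvd_sum) (simp add: coroot_coords_short[OF assms])
  moreover have "even (\<Sum>j\<in>S. \<Sum>k\<in>-S. ?t j k)"
    by (intro dvd_sum) (simp add: even_short_long)
  moreover have "coord_pairing A r s =
      (\<Sum>j\<in>S. \<Sum>k\<in>S. ?t j k) + (\<Sum>j\<in>S. \<Sum>k\<in>-S. ?t j k) + (\<Sum>j\<in>-S. \<Sum>k\<in>UNIV. ?t j k)"
    unfolding coord_pairing_def
    by (subst split, subst split) (simp add: sum.distrib)
  moreover have "(\<Sum>j\<in>S. \<Sum>k\<in>S. ?t j k) = (\<Sum>j\<in>S. \<Sum>k\<in>S. root_coords A r j * A j k * root_coords A s k)"
    by (simp add: coroot_coords_short[OF assms])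
  ultimately show ?thesis by simp
qed

lemma snd_in_iff: "snd r \<in> S \<longleftrightarrow> \<epsilon> (snd r) = 2 * e"
  using e_pos by (simp add: weight)

lemma double_bond_short:
  assumes "coord_pairing A r s = -2" "coord_pairing A s r = -1"
  shows "snd r \<in> S"
  using double_bond_ratio[OF sym assms] e_pos by (auto simp: weight split: if_splits)

lemma single_bond_short:
  assumes "snd s \<in> S" "coord_pairing A r s = -1" "coord_pairing A s r = -1"
  shows "snd r \<in> S"
  using single_bond_ratio[OF sym assms(2,3)] assms(1) by (simp add: snd_in_iff)

lemma short_pairing_even:
  assumes "S = {p}" "snd r \<in> S"
  shows "even (coord_pairing A r s)"
  using coord_pairing_mod2[OF assms(2), of s] by (simp add: assms(1) diag)

text \<open>Modulo 2 the diagonal entries vanish and signs do not matter, so the form with the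
  \<open>A_2\<close> matrix becomes the determinant of the two coordinate vectors.\<close>

lemma short_pairing_symplectic:
  assumes "S = {p, q}" "p \<noteq> q" "A p q = -1" "A q p = -1" "snd r \<in> S"
  shows "even (coord_pairing A r s - (root_coords A r p * root_coords A s q - root_coords A r q * root_coords A s p))"
  using coord_pairing_mod2[OF assms(5), of s] assms(2-4) by (simp add: assms(1) diag)

text \<open>Reflections act invertibly on the two coordinates modulo 2: trivially for
  \<open>k\<close> outside \<open>S\<close>, and for \<open>k\<close> in \<open>S\<close> by adding
  the other coordinate to the one at \<open>k\<close>, since the entries \<open>A k l\<close> with
  \<open>l\<close> outside \<open>S\<close> are even.\<close>

lemma short_root_odd:
  assumes "S = {p, q}" "p \<noteq> q" "A p q = -1" "A q p = -1" "snd r \<in> S"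
  shows "odd (root_coords A r p) \<or> odd (root_coords A r q)"
proof -
  obtain w i where r: "r = (w, i)" by (cases r)
  have "odd (root_coords A (w, i) p) \<or> odd (root_coords A (w, i) q)"
  proof (induction w)
    case Nil
    then show ?case using assms(1,5) by (auto simp: r)
  next
    case (Cons k w)
    let ?x = "root_coords A (w, i)"
    have split: "sum f UNIV = f p + f q + sum f (- S)" for f :: "'i \<Rightarrow> int"
      using sum.subset_diff[of S UNIV f] assms(1,2) by (simp add: Compl_eq_Diff_UNIV)
    have "even (\<Sum>l\<in>-S. A j l * ?x l)" if "j \<in> S" for j
      using that by (intro dvd_sum) (simp add: even_short_long)
    then have ev: "even (\<Sum>l\<in>-S. A p l * ?x l)" "even (\<Sum>l\<in>-S. A q l * ?x l)"
      using assms(1) by auto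
    then show ?case using Cons assms(2-4)
      by (auto simp: coord_refl_def split diag)
  qed
  then show ?thesis by (simp add: r)
qed

section \<open>Diagrams excluded by the parity of pairings\<close>

lemma no_C3:
  assumes "S = {p}"
  shows "\<not> realizes A (diagram_C 3) r"
proof
  assume "realizes A (diagram_C 3) r"
  moreover have "length (diagram_C 3) + 1 = 3" by (simp add: diagram_C_def)
  ultimately have M: "coord_pairing A (r m) (r n) = linear_gcm (diagram_C 3) m n"
    if "m \<in> {1..3}" "n \<in> {1..3}" for m n
    using that by (simp only: realizes_def)
  \<comment> \<open>The arrow between 2 and 3 points to 2, so vertex 2 is short, yet its edge to
    vertex 1 is an odd pairing.\<close>
  have "snd (r 2) \<in> S"
    by (rule double_bond_short[of _ "r 3"]) (simp_all add: M linear_gcm_def diagram_C_def numeral_eq_Suc)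
  then have "even (coord_pairing A (r 2) (r 1))"
    by (rule short_pairing_even[OF assms(1)])
  then show False by (simp add: M linear_gcm_def diagram_C_def)
qed

text \<open>An alternating form on a plane has rank at most 2. For vertices 1 to 4 this is a
  relation between determinants: \<open>?d 1 2 * ?d 3 4\<close> is odd, but the other side is even
  since 1 is joined neither to 3 nor to 4.\<close>

lemma no_C5:
  assumes S: "S = {p, q}" "p \<noteq> q" "A p q = -1" "A q p = -1"
  shows "\<not> realizes A (diagram_C 5) r"
proof
  assume "realizes A (diagram_C 5) r"
  moreover have "length (diagram_C 5) + 1 = 5" by (simp add: diagram_C_def)
  ultimately have M: "coord_pairing A (r m) (r n) = linear_gcm (diagram_C 5) m n"
    if "m \<in> {1..5}" "n \<in> {1..5}" for m n
    using that by (simp only: realizes_def)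
  have 4: "snd (r 4) \<in> S"
    by (rule double_bond_short[of _ "r 5"]) (simp_all add: M linear_gcm_def diagram_C_def numeral_eq_Suc)
  have 3: "snd (r 3) \<in> S"
    by (rule single_bond_short[OF 4]) (simp_all add: M linear_gcm_def diagram_C_def numeral_eq_Suc)
  have 2: "snd (r 2) \<in> S"
    by (rule single_bond_short[OF 3]) (simp_all add: M linear_gcm_def diagram_C_def numeral_eq_Suc)
  have 1: "snd (r 1) \<in> S"
    by (rule single_bond_short[OF 2]) (simp_all add: M linear_gcm_def diagram_C_def numeral_eq_Suc)
  let ?d = "\<lambda>m n. root_coords A (r m) p * root_coords A (r n) q - root_coords A (r m) q * root_coords A (r n) p"
  have "even (coord_pairing A (r m) (r n) - ?d m n)" if "m \<in> {1..4}" for m n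
  proof -
    have "m = 1 \<or> m = 2 \<or> m = 3 \<or> m = 4" using that by auto
    then have "snd (r m) \<in> S" using 1 2 3 4 by auto
    then show ?thesis by (rule short_pairing_symplectic[OF S])
  qed
  from this[of 1 2] this[of 3 4] this[of 1 3] this[of 1 4]
  have "odd (?d 1 2)" "odd (?d 3 4)" "even (?d 1 3)" "even (?d 1 4)"
    by (simp_all add: M linear_gcm_def diagram_C_def numeral_eq_Suc)
  \<comment> \<open>Pluecker relation\<close>
  moreover have "?d 1 2 * ?d 3 4 = ?d 1 3 * ?d 2 4 - ?d 1 4 * ?d 2 3" by algebra
  ultimately show False by (metis even_diff even_mult_iff even_add)
qed

text \<open>Vertices 1 and 2 have odd determinant, hence form a basis modulo 2. Vertex 4, short by
  the arrow pointing to it, is orthogonal to both, so its coordinates are even, against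
  \<open>short_root_odd\<close>.\<close>

lemma no_HD3_2:
  assumes S: "S = {p, q}" "p \<noteq> q" "A p q = -1" "A q p = -1"
  shows "\<not> realizes A diagram_HD3_2 r"
proof
  assume "realizes A diagram_HD3_2 r"
  moreover have "length diagram_HD3_2 + 1 = 4" by (simp add: diagram_HD3_2_def)
  ultimately have M: "coord_pairing A (r m) (r n) = linear_gcm diagram_HD3_2 m n"
    if "m \<in> {1..4}" "n \<in> {1..4}" for m n
    using that by (simp only: realizes_def)
  have 2: "snd (r 2) \<in> S"
    by (rule double_bond_short[of _ "r 3"]) (simp_all add: M linear_gcm_def diagram_HD3_2_def numeral_eq_Suc)
  have 1: "snd (r 1) \<in> S"
    by (rule single_bond_short[OF 2]) (simp_all add: M linear_gcm_def diagram_HD3_2_def numeral_eq_Suc)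
  have 4: "snd (r 4) \<in> S"
    by (rule double_bond_short[of _ "r 3"]) (simp_all add: M linear_gcm_def diagram_HD3_2_def numeral_eq_Suc)
  let ?d = "\<lambda>m n. root_coords A (r m) p * root_coords A (r n) q - root_coords A (r m) q * root_coords A (r n) p"
  have "even (coord_pairing A (r 1) (r n) - ?d 1 n)" "even (coord_pairing A (r 2) (r n) - ?d 2 n)" for n
    using short_pairing_symplectic[OF S] 1 2 by blast+
  from this(1)[of 2] this(1)[of 4] this(2)[of 4]
  have "odd (?d 1 2)" "even (?d 1 4)" "even (?d 2 4)"
    by (simp_all add: M linear_gcm_def diagram_HD3_2_def numeral_eq_Suc)
  moreover have "odd (root_coords A (r 4) p) \<or> odd (root_coords A (r 4) q)"
    using short_root_odd[OF S 4] .
  ultimately show False by auto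
qed

end


section \<open>Real roots and coroots of a Kac-Moody algebra\<close>

lemma vector_space_scale_dual: "vector_space (scale_dual :: complex \<Rightarrow> ('h \<Rightarrow> complex) \<Rightarrow> _)"
  by unfold_locales (auto simp: scale_dual_def fun_eq_iff algebra_simps)

lemma sum_apply: "(\<Sum>x\<in>F. f x) h = (\<Sum>x\<in>F. f x h)" for f :: "'a \<Rightarrow> 'b \<Rightarrow> 'c::comm_monoid_add"
  by (induction F rule: infinite_finite_induct) auto

lemma Re_of_rat: "Re (of_rat q) = of_rat q"
proof -
  have "(of_rat q :: complex) = of_real (of_rat q)"
    by (cases q) (simp add: of_rat_rat)
  then show ?thesis by simp
qed

text \<open>Names the symmetrization behind the invariant form, so that root lengths and coordinate
  lemmas share the weights \<open>\<epsilon>\<close>.\<close>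

locale kac_moody_form = kac_moody_algebra G
  for G :: "('g::ab_group_add, 'h::ab_group_add, 'i::finite) kac_moody" +
  fixes K :: "'g \<Rightarrow> 'g \<Rightarrow> complex" and \<epsilon> :: "'i \<Rightarrow> rat"
  assumes form_linear: "Vector_Spaces.linear (scale_g G) (*) (K x)"
    and form_sym: "K x y = K y x"
    and sym: "symmetrized_by (gcm G) \<epsilon>"
    and form_coroot:
      "K (cartan G (simple_coroot G i)) (cartan G h) = of_rat (\<epsilon> i) * simple_root G i h"
begin

abbreviation rt :: "'i list \<times> 'i \<Rightarrow> 'h \<Rightarrow> complex" where
  "rt r \<equiv> weyl_act G (fst r) (simple_root G (snd r))"

abbreviation crt :: "'i list \<times> 'i \<Rightarrow> 'h" where
  "crt r \<equiv> weyl_coact G (fst r) (simple_coroot G (snd r))"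

abbreviation nu :: "'h \<Rightarrow> 'h \<Rightarrow> complex" where
  "nu \<equiv> form_nu G K"

lemma weight_pos: "\<epsilon> i > 0"
  using sym by (simp add: symmetrized_by_def)

lemma gcm_diag: "gcm G i i = 2"
  using gcm by (simp add: gen_cartan_matrix_def)

lemma weyl_Nil [simp]: "weyl_act G [] \<phi> = \<phi>" "weyl_coact G [] h = h"
  by (simp_all add: weyl_act_def weyl_coact_def)

lemma weyl_Cons [simp]:
  "weyl_act G (k # w) \<phi> = refl G k (weyl_act G w \<phi>)"
  "weyl_coact G (k # w) h = corefl G k (weyl_coact G w h)"
  by (simp_all add: weyl_act_def weyl_coact_def)

abbreviation functional :: "('h \<Rightarrow> complex) \<Rightarrow> bool" where
  "functional \<equiv> Vector_Spaces.linear (scale_h G) (*)"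

lemma functional_iff:
  "functional \<phi> \<longleftrightarrow> (\<forall>x y. \<phi> (x + y) = \<phi> x + \<phi> y) \<and> (\<forall>c x. \<phi> (scale_h G c x) = c * \<phi> x)"
proof -
  have "vector_space ((*) :: complex \<Rightarrow> complex \<Rightarrow> complex)"
    by unfold_locales (auto simp: algebra_simps)
  then show ?thesis
    using vector_space_h by (auto simp: Vector_Spaces.linear_iff)
qed

lemma functional_zero: "functional \<phi> \<Longrightarrow> \<phi> 0 = 0"
  unfolding functional_iff by (metis add_cancel_right_right)

lemma functional_diff: "functional \<phi> \<Longrightarrow> \<phi> (x - y) = \<phi> x - \<phi> y"
  unfolding functional_iff by (metis add_diff_cancel_right' diff_add_cancel)

lemma functional_scale: "functional \<phi> \<Longrightarrow> \<phi> (scale_h G c x) = c * \<phi> x"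
  by (simp add: functional_iff)

lemma functional_sum: "functional \<phi> \<Longrightarrow> \<phi> (sum f F) = (\<Sum>x\<in>F. \<phi> (f x))"
  by (induction F rule: infinite_finite_induct) (simp_all add: functional_zero functional_iff)

lemma functional_refl: "functional \<phi> \<Longrightarrow> functional (refl G k \<phi>)"
  using simple_root_linear[of k] by (auto simp: functional_iff refl_def algebra_simps)

lemma functional_rt: "functional (rt r)"
proof (induction "fst r" arbitrary: r)
  case Nil
  then show ?case by (metis simple_root_linear weyl_Nil(1))
next
  case (Cons k w)
  then show ?case
    using functional_refl[of "rt (w, snd r)" k] by (metis fst_conv snd_conv weyl_Cons(1))
qed

text \<open>Induction on the word: \<open>refl G k\<close> subtracts a multiple of the
  \<open>k\<close>-th simple root, and that multiple is the sum in
  \<open>coord_refl\<close>.\<close>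

lemma rt_eq_sum: "rt r = (\<lambda>h. \<Sum>j\<in>UNIV. of_int (root_coords (gcm G) r j) * simple_root G j h)"
proof -
  obtain w i where r: "r = (w, i)" by (cases r)
  have "rt (w, i) = (\<lambda>h. \<Sum>j\<in>UNIV. of_int (root_coords (gcm G) (w, i) j) * simple_root G j h)"
  proof (induction w)
    case Nil
    have "of_int (of_bool (j = i)) * simple_root G j h = (if j = i then simple_root G j h else 0)" for j h
      by simp
    then show ?case by (simp only: root_coords_Nil) simp
  next
    case (Cons k w)
    let ?x = "root_coords (gcm G) (w, i)" and ?c = "\<Sum>l\<in>UNIV. gcm G k l * root_coords (gcm G) (w, i) l"
    have c: "rt (w, i) (simple_coroot G k) = of_int ?c"
      unfolding Cons by (simp add: pairing mult.commute)
    have *: "of_int (coord_refl (gcm G) k ?x j) * simple_root G j h =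
      of_int (?x j) * simple_root G j h - (if j = k then of_int ?c * simple_root G j h else 0)" for j h
      by (simp add: coord_refl_def algebra_simps)
    have "rt (k # w, i) h = (\<Sum>j\<in>UNIV. of_int (root_coords (gcm G) (k # w, i) j) * simple_root G j h)" for h
    proof -
      have "rt (k # w, i) h = rt (w, i) h - of_int ?c * simple_root G k h"
        using c by (simp add: refl_def)
      also have "\<dots> = (\<Sum>j\<in>UNIV. of_int (root_coords (gcm G) (k # w, i) j) * simple_root G j h)"
        unfolding root_coords_Cons * sum_subtractf by (subst Cons) simp
      finally show ?thesis .
    qed
    then show ?case by blast
  qed
  then show ?thesis by (simp add: r)
qed

text \<open>As for roots, but the \<open>k\<close>-th simple root takes the value
  \<open>gcm G l k\<close> on the \<open>l\<close>-th simple coroot, which brings in the transposed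
  matrix.\<close>

lemma crt_eq_sum:
  "crt r = (\<Sum>j\<in>UNIV. scale_h G (of_int (root_coords (dual_gcm (gcm G)) r j)) (simple_coroot G j))"
proof -
  interpret H: vector_space "scale_h G" by (rule vector_space_h)
  obtain w i where r: "r = (w, i)" by (cases r)
  let ?x = "\<lambda>w. root_coords (dual_gcm (gcm G)) (w, i)"
  have "crt (w, i) = (\<Sum>j\<in>UNIV. scale_h G (of_int (?x w j)) (simple_coroot G j))"
  proof (induction w)
    case Nil
    have "scale_h G (of_int (of_bool (j = i))) (simple_coroot G j) =
      (if j = i then simple_coroot G j else 0)" for j
      by simp
    then show ?case by (simp only: root_coords_Nil) simp
  next
    case (Cons k w)
    let ?c = "\<Sum>l\<in>UNIV. dual_gcm (gcm G) k l * ?x w l"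
    have c: "simple_root G k (crt (w, i)) = of_int ?c"
      unfolding Cons
      by (simp add: functional_sum functional_scale simple_root_linear pairing dual_gcm_def mult.commute)
    have *: "scale_h G (of_int (coord_refl (dual_gcm (gcm G)) k (?x w) j)) (simple_coroot G j) =
      scale_h G (of_int (?x w j)) (simple_coroot G j) -
      (if j = k then scale_h G (of_int ?c) (simple_coroot G j) else 0)" for j
      by (simp add: coord_refl_def H.scale_left_diff_distrib)
    have "crt (k # w, i) = crt (w, i) - scale_h G (of_int ?c) (simple_coroot G k)"
      using c by (simp add: corefl_def)
    also have "\<dots> = (\<Sum>j\<in>UNIV. scale_h G (of_int (?x (k # w) j)) (simple_coroot G j))"
      unfolding root_coords_Cons * sum_subtractf by (subst Cons) simp
    finally show ?case .
  qed
  then show ?thesis by (simp add: r)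
qed

lemma rt_crt: "rt s (crt r) = of_int (coord_pairing (gcm G) r s)"
proof -
  have "simple_root G k (crt r) =
    (\<Sum>j\<in>UNIV. of_int (root_coords (dual_gcm (gcm G)) r j) * of_int (gcm G j k))" for k
    unfolding crt_eq_sum
    by (simp add: functional_sum functional_scale simple_root_linear pairing)
  then have "rt s (crt r) = (\<Sum>k\<in>UNIV. \<Sum>j\<in>UNIV. of_int (root_coords (dual_gcm (gcm G)) r j) *
     of_int (gcm G j k) * of_int (root_coords (gcm G) s k))"
    unfolding rt_eq_sum by (simp add: sum_distrib_left sum_distrib_right mult_ac)
  also have "\<dots> = of_int (coord_pairing (gcm G) r s)"
    unfolding coord_pairing_def of_int_sum of_int_mult by (rule sum.swap)
  finally show ?thesis .
qed

lemma refl_corefl: "functional \<phi> \<Longrightarrow> refl G k \<phi> (corefl G k h) = \<phi> h"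
  by (simp add: refl_def corefl_def functional_diff functional_scale simple_root_linear pairing
      gcm_diag algebra_simps)

lemma rt_crt_self: "rt r (crt r) = 2"
proof -
  obtain w i where r: "r = (w, i)" by (cases r)
  have "rt (w, i) (crt (w, i)) = 2"
  proof (induction w)
    case Nil
    then show ?case by (simp add: pairing gcm_diag)
  next
    case (Cons k w)
    then show ?case using functional_rt[of "(w, i)"] by (simp add: refl_corefl)
  qed
  then show ?thesis by (simp add: r)
qed

section \<open>The invariant form and the lengths of real roots\<close>

lemma functional_nu: "functional (nu h)"
  using form_linear[of "cartan G h"] cartan_linear unfolding functional_iff
  by (simp add: form_nu_def Vector_Spaces.linear_iff)

lemma nu_sym: "nu h h' = nu h' h"
  by (simp add: form_nu_def form_sym)

text \<open>Symmetry of the form and its values on simple coroots give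
  \<open>nu (corefl G k h) = refl G k (nu h)\<close>, so the relation spreads from simple coroots
  along Weyl orbits.\<close>

lemma nu_crt: "nu (crt r) = (\<lambda>h. of_rat (\<epsilon> (snd r)) * rt r h)"
proof -
  obtain w i where r: "r = (w, i)" by (cases r)
  have "nu (crt (w, i)) = (\<lambda>h. of_rat (\<epsilon> i) * rt (w, i) h)"
  proof (induction w)
    case Nil
    then show ?case by (simp add: form_nu_def form_coroot)
  next
    case (Cons k w)
    have nu_simple: "nu (simple_coroot G k) h = of_rat (\<epsilon> k) * simple_root G k h" for h
      by (simp add: form_nu_def form_coroot)
    have "nu (corefl G k h) h' = refl G k (nu h) h'" for h h'
    proof -
      have "nu (corefl G k h) h' = nu h' h - simple_root G k h * nu h' (simple_coroot G k)"
        by (subst nu_sym) (simp add: corefl_def functional_diff functional_scale functional_nu)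
      also have "\<dots> = nu h h' - simple_root G k h * nu (simple_coroot G k) h'"
        by (simp only: nu_sym[of h'])
      also have "\<dots> = nu h h' - nu (simple_coroot G k) h * simple_root G k h'"
        by (simp add: nu_simple)
      also have "\<dots> = refl G k (nu h) h'"
        by (simp only: refl_def nu_sym[of h])
      finally show ?thesis .
    qed
    then have "nu (crt (k # w, i)) = refl G k (nu (crt (w, i)))" by (simp add: fun_eq_iff)
    then show ?case by (simp only: Cons) (simp add: refl_def algebra_simps)
  qed
  then show ?thesis by (simp add: r)
qed

lemma dual_form_rt: "dual_form G K (rt r) (rt r) = 2 / of_rat (\<epsilon> (snd r))"
proof -
  interpret H: vector_space "scale_h G" by (rule vector_space_h)
  let ?e = "of_rat (\<epsilon> (snd r)) :: complex"
  have e: "?e \<noteq> 0" using weight_pos[of "snd r"] by simp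
  define h where "h = scale_h G (1 / ?e) (crt r)"
  have h: "nu h = rt r"
  proof
    fix h'
    have "nu h h' = 1 / ?e * nu (crt r) h'"
      by (simp add: h_def nu_sym[of _ h'] functional_scale functional_nu)
    then show "nu h h' = rt r h'" using e by (simp add: nu_crt)
  qed
  \<comment> \<open>\<open>inv nu\<close> picks some preimage \<open>g\<close> of the root; symmetry
    of the form lets \<open>g\<close> be exchanged for the explicit preimage
    \<open>h\<close>.\<close>
  define g where "g = inv nu (rt r)"
  have g: "nu g = rt r"
    unfolding g_def by (rule f_inv_into_f) (metis h rangeI)
  have "dual_form G K (rt r) (rt r) = nu g g"
    by (simp add: dual_form_def g_def form_nu_def)
  also have "\<dots> = nu h g" by (simp add: g h)
  also have "\<dots> = nu g h" by (rule nu_sym)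
  also have "\<dots> = rt r h" by (simp add: g)
  also have "\<dots> = 2 / ?e" by (simp add: h_def functional_scale functional_rt rt_crt_self)
  finally show ?thesis .
qed

lemma root_length_rt: "root_length G K (rt r) = sqrt (2 / of_rat (\<epsilon> (snd r)))"
proof -
  have "(2 / of_rat (\<epsilon> (snd r)) :: complex) = of_rat (2 / \<epsilon> (snd r))"
    by (simp add: of_rat_divide)
  then have "Re (dual_form G K (rt r) (rt r)) = of_rat (2 / \<epsilon> (snd r))"
    by (simp add: dual_form_rt Re_of_rat)
  then show ?thesis by (simp add: root_length_def of_rat_divide)
qed

section \<open>Well-definedness of coroots\<close>

lemma simple_root_coeffs_unique:
  assumes "(\<lambda>h. \<Sum>j\<in>UNIV. c j * simple_root G j h) = (\<lambda>h. \<Sum>j\<in>UNIV. d j * simple_root G j h)"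
  shows "c = d"
proof -
  interpret D: vector_space "scale_dual :: complex \<Rightarrow> ('h \<Rightarrow> complex) \<Rightarrow> _"
    by (rule vector_space_scale_dual)
  \<comment> \<open>Independence is stated for the set of simple roots, so the coefficients have to
    be functions of the root; injectivity recovers the index.\<close>
  let ?u = "\<lambda>\<phi>. c (inv (simple_root G) \<phi>) - d (inv (simple_root G) \<phi>)"
  have "(\<Sum>\<phi>\<in>range (simple_root G). scale_dual (?u \<phi>) \<phi>) =
      (\<Sum>j\<in>UNIV. scale_dual (c j - d j) (simple_root G j))"
    by (subst sum.reindex) (simp_all add: simple_root_indep(1))
  also have "\<dots> = 0"
    using assms by (simp add: fun_eq_iff sum_apply scale_dual_def left_diff_distrib sum_subtractf)
  finally have "(\<Sum>\<phi>\<in>range (simple_root G). scale_dual (?u \<phi>) \<phi>) = 0" .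
  then have "?u \<phi> = 0" if "\<phi> \<in> range (simple_root G)" for \<phi>
    using D.independentD[OF simple_root_indep(2), of "range (simple_root G)" ?u \<phi>] that by simp
  then have "c j - d j = 0" for j
    using simple_root_indep(1) by (metis inv_f_f rangeI)
  then show ?thesis by (simp add: fun_eq_iff)
qed

text \<open>Makes \<open>coroot\<close> well defined. Equal roots have equal coordinates by
  independence and equal weights by comparing norms; \<open>coroot_coords\<close> then fixes the
  coroot.\<close>

lemma crt_unique:
  assumes "rt r = rt s"
  shows "crt r = crt s"
proof -
  have "(\<lambda>j. of_int (root_coords (gcm G) r j) :: complex) = (\<lambda>j. of_int (root_coords (gcm G) s j))"
    using assms by (intro simple_root_coeffs_unique) (simp only: rt_eq_sum)
  then have x: "root_coords (gcm G) r j = root_coords (gcm G) s j" for j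
    by (metis of_int_eq_iff)
  have "(2 / of_rat (\<epsilon> (snd r)) :: complex) = 2 / of_rat (\<epsilon> (snd s))"
    using assms dual_form_rt[of r] dual_form_rt[of s] by simp
  then have e: "\<epsilon> (snd r) = \<epsilon> (snd s)" by simp
  have "root_coords (dual_gcm (gcm G)) r j = root_coords (dual_gcm (gcm G)) s j" for j
  proof -
    have "\<epsilon> j * of_int (root_coords (dual_gcm (gcm G)) r j) = \<epsilon> j * of_int (root_coords (dual_gcm (gcm G)) s j)"
      by (simp only: coroot_coords[OF sym] x e)
    then show ?thesis using weight_pos[of j] by simp
  qed
  then show ?thesis unfolding crt_eq_sum by simp
qed

lemma coroot_rt: "coroot G (rt r) = crt r"
  unfolding coroot_def
proof (rule the_equality)
  show "\<exists>w i. rt r = weyl_act G w (simple_root G i) \<and> crt r = weyl_coact G w (simple_coroot G i)"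
    by (intro exI conjI) (rule refl)+
next
  fix h
  assume "\<exists>w i. rt r = weyl_act G w (simple_root G i) \<and> h = weyl_coact G w (simple_coroot G i)"
  then obtain w i where wi: "rt r = weyl_act G w (simple_root G i)" "h = weyl_coact G w (simple_coroot G i)"
    by (elim exE conjE)
  have "crt r = crt (w, i)"
    by (rule crt_unique) (simp only: wi fst_conv snd_conv)
  then show "h = crt r" by (simp only: wi fst_conv snd_conv)
qed

section \<open>From subdiagrams of a \<pi>-system to coordinates\<close>

lemma pi_matrix_rt: "pi_matrix G (rt r) (rt s) = of_int (coord_pairing (gcm G) r s)"
  by (simp add: pi_matrix_def coroot_rt rt_crt)

lemma real_roots_eq: "real_roots G = range rt"
  unfolding real_roots_def by (simp add: image_def)

text \<open>Each vertex is pulled back along the diagram isomorphism, and a word is chosen for the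
  real root found there.\<close>

lemma subdiagram_coords:
  assumes "Y \<subseteq> real_roots G" "occurs_as_subdiagram bs Y (pi_matrix G)"
  obtains r where "realizes (gcm G) bs r"
proof -
  obtain W f where W: "W \<subseteq> Y" and f: "bij_betw f W {1..length bs + 1}"
    and M: "\<And>u v. u \<in> W \<Longrightarrow> v \<in> W \<Longrightarrow> pi_matrix G u v = of_int (linear_gcm bs (f u) (f v))"
    using assms(2) by (auto simp: occurs_as_subdiagram_def diagram_of_type_def)
  let ?g = "inv_into W f"
  have g: "?g m \<in> W" "f (?g m) = m" if "m \<in> {1..length bs + 1}" for m
    using that f by (auto simp: bij_betw_def inv_into_into f_inv_into_f)
  have "\<exists>r. ?g m = rt r" if "m \<in> {1..length bs + 1}" for m
  proof -
    have "?g m \<in> real_roots G" using g(1)[OF that] W assms(1) by blast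
    then obtain r where "?g m = rt r" unfolding real_roots_eq by (rule rangeE)
    then show ?thesis by (rule exI)
  qed
  then have "\<forall>m\<in>{1..length bs + 1}. \<exists>r. ?g m = rt r" by (rule ballI)
  from bchoice[OF this] obtain r where "\<forall>m\<in>{1..length bs + 1}. ?g m = rt (r m)" by (rule exE)
  then have r: "?g m = rt (r m)" if "m \<in> {1..length bs + 1}" for m using that by (rule bspec)
  have "coord_pairing (gcm G) (r m) (r n) = linear_gcm bs m n"
    if "m \<in> {1..length bs + 1}" "n \<in> {1..length bs + 1}" for m n
  proof -
    have "(of_int (coord_pairing (gcm G) (r m) (r n)) :: complex) = of_int (linear_gcm bs m n)"
      using M[of "?g m" "?g n"] g[OF that(1)] g[OF that(2)]
      by (simp add: r[OF that(1)] r[OF that(2)] pi_matrix_rt)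
    then show ?thesis by simp
  qed
  then have "realizes (gcm G) bs r" by (simp only: realizes_def ball_simps) blast
  then show ?thesis by (rule that)
qed

section \<open>Weights of short and long simple roots\<close>

lemma root_length_simple: "root_length G K (simple_root G i) = sqrt (2 / of_rat (\<epsilon> i))"
  using root_length_rt[of "([], i)"] by simp

lemma root_length_less_iff:
  "root_length G K (simple_root G i) < root_length G K (simple_root G j) \<longleftrightarrow> \<epsilon> j < \<epsilon> i"
proof -
  have "(of_rat (\<epsilon> i) :: real) > 0" "(of_rat (\<epsilon> j) :: real) > 0"
    using weight_pos by simp_all
  then have "2 / of_rat (\<epsilon> i) < (2 / of_rat (\<epsilon> j) :: real) \<longleftrightarrow> of_rat (\<epsilon> j) < (of_rat (\<epsilon> i) :: real)"
    by (simp add: divide_less_eq less_divide_eq field_simps)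
  then show ?thesis by (simp only: root_length_simple real_sqrt_less_iff of_rat_less)
qed

text \<open>Length is constant on Weyl orbits, so two real root lengths mean two lengths of simple
  roots. The ends of a double edge realize both, with weights in the ratio 2.\<close>

lemma two_weights:
  assumes "doubly_laced (gcm G)" "card (root_length G K ` real_roots G) = 2"
  obtains e where "e > 0" "\<And>i. \<epsilon> i = (if i \<in> X_short G K then 2 * e else e)"
    "X_long G K = - X_short G K"
proof -
  let ?L = "\<lambda>i. root_length G K (simple_root G i)"
  have "root_length G K (rt r) = ?L (snd r)" for r
    by (simp only: root_length_rt root_length_simple)
  then have "root_length G K ` real_roots G = ?L ` range (snd :: 'i list \<times> 'i \<Rightarrow> 'i)"
    unfolding real_roots_eq by (simp only: image_image)
  then have "root_length G K ` real_roots G = range ?L"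
    by (simp only: range_snd)
  then have card: "card (range ?L) = 2" using assms(2) by simp
  obtain i j where "{gcm G i j, gcm G j i} = {-1, -2}"
    using assms(1) unfolding doubly_laced_def by (elim conjE exE)
  then have "gcm G i j = -2 \<and> gcm G j i = -1 \<or> gcm G j i = -2 \<and> gcm G i j = -1"
    by (auto simp: doubleton_eq_iff)
  then obtain p q where pq: "gcm G p q = -2" "gcm G q p = -1" by blast
  have "of_int (gcm G p q) / \<epsilon> p = of_int (gcm G q p) / \<epsilon> q"
    using sym by (auto simp: symmetrized_by_def)
  then have e: "\<epsilon> p = 2 * \<epsilon> q"
    using weight_pos[of p] weight_pos[of q] by (simp add: pq field_simps)
  then have less: "?L p < ?L q" using weight_pos[of q] by (simp add: root_length_less_iff)
  have range: "range ?L = {?L p, ?L q}"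
    using card less by (intro card_subset_eq[symmetric]) auto
  have inj: "\<epsilon> i = \<epsilon> j" if "?L i = ?L j" for i j
    using that root_length_less_iff[of i j] root_length_less_iff[of j i] by linarith
  have short: "X_short G K = {i. ?L i = ?L p}" and long: "X_long G K = {i. ?L i = ?L q}"
    unfolding X_short_def X_long_def range using less by simp_all
  have cases: "?L i = ?L p \<or> ?L i = ?L q" for i using range by auto
  show ?thesis
  proof
    show "\<epsilon> q > 0" by (rule weight_pos)
    show "\<epsilon> i = (if i \<in> X_short G K then 2 * \<epsilon> q else \<epsilon> q)" for i
      unfolding short using cases[of i] inj[of i p] inj[of i q] e by auto
    have "?L i = ?L q \<longleftrightarrow> ?L i \<noteq> ?L p" for i using cases[of i] less by linarith
    then show "X_long G K = - X_short G K" unfolding short long by blast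
  qed
qed

end

section \<open>Linear diagrams\<close>

lemma diagram_A1_singleton:
  assumes "diagram_of_type S M (diagram_A 1)"
  obtains p where "S = {p}"
proof -
  obtain f where "bij_betw f S {1..length (diagram_A 1) + 1}"
    using assms by (auto simp: diagram_of_type_def)
  then have "card S = 1" by (auto dest!: bij_betw_same_card simp: diagram_A_def)
  then show ?thesis using that by (auto simp: card_1_singleton_iff)
qed

lemma diagram_A2_pair:
  fixes M :: "'i \<Rightarrow> 'i \<Rightarrow> int"
  assumes "diagram_of_type S M (diagram_A 2)"
  obtains p q where "S = {p, q}" "p \<noteq> q" "M p q = -1" "M q p = -1"
proof -
  obtain f where f: "bij_betw f S {1..2::nat}"
    and M: "\<And>u v. u \<in> S \<Longrightarrow> v \<in> S \<Longrightarrow> M u v = linear_gcm (diagram_A 2) (f u) (f v)"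
    using assms by (auto simp: diagram_of_type_def diagram_A_def numeral_eq_Suc)
  have "{1..2::nat} = {1, 2}" by auto
  then have "f ` S = {1, 2}" using f by (simp add: bij_betw_def)
  then obtain p q where pq: "p \<in> S" "q \<in> S" "f p = 1" "f q = 2"
    by (metis imageE insertI1 insertI2)
  have "card S = 2" using bij_betw_same_card[OF f] by simp
  moreover have "p \<noteq> q" using pq by auto
  ultimately have "S = {p, q}"
    using pq by (intro card_subset_eq[symmetric]) (auto intro: card_ge_0_finite)
  then show ?thesis
    using that[of p q] \<open>p \<noteq> q\<close> pq M[of p q] M[of q p] by (simp add: linear_gcm_def diagram_A_def)
qed

section \<open>Reversal of arrows\<close>

fun flip_bond :: "bond \<Rightarrow> bond" where
  "flip_bond Bond_Single = Bond_Single"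
| "flip_bond Bond_Right = Bond_Left"
| "flip_bond Bond_Left = Bond_Right"

lemma flip_bond_iff [simp]:
  "flip_bond b = Bond_Right \<longleftrightarrow> b = Bond_Left" "flip_bond b = Bond_Left \<longleftrightarrow> b = Bond_Right"
  by (cases b; simp)+

text \<open>Reversing an arrow swaps its \<open>-2\<close> and \<open>-1\<close>. The bounds on
  \<open>i\<close> and \<open>j\<close> keep list indices in range, where \<open>map\<close>
  commutes with \<open>!\<close>.\<close>

lemma linear_gcm_flip:
  assumes "i \<in> {1..length bs + 1}" "j \<in> {1..length bs + 1}"
  shows "linear_gcm (map flip_bond bs) i j = linear_gcm bs j i"
  using assms by (auto simp: linear_gcm_def)

text \<open>Reduces the exclusion of \<open>B_n\<close> to that of \<open>C_n\<close> for the
  transposed matrix.\<close>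

lemma realizes_flip:
  assumes "realizes A (map flip_bond bs) r"
  shows "realizes (dual_gcm A) bs r"
  unfolding realizes_def
proof (intro ballI)
  fix m n
  assume mn: "m \<in> {1..length bs + 1}" "n \<in> {1..length bs + 1}"
  then have "coord_pairing A (r n) (r m) = linear_gcm (map flip_bond bs) n m"
    using assms by (simp only: realizes_def length_map)
  then show "coord_pairing (dual_gcm A) (r m) (r n) = linear_gcm bs m n"
    by (simp only: coord_pairing_dual linear_gcm_flip[OF mn(2,1)])
qed

theorem proposition5p7:
  fixes G :: "('g::ab_group_add, 'h::ab_group_add, 'i::finite) kac_moody"
    and K :: "'g \<Rightarrow> 'g \<Rightarrow> complex"
    and Y :: "('h \<Rightarrow> complex) set"
  assumes "kac_moody_algebra G"
    and "symmetrizable (gcm G)"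
    and "doubly_laced (gcm G)"
    and "standard_invariant_form G K"
    and "card (root_length G K ` real_roots G) = 2"
    and "pi_system G Y"
    and "\<not> module.dependent scale_dual Y"
  shows "(diagram_of_type (X_short G K) (gcm G) (diagram_A 1) \<longrightarrow>
            \<not> occurs_as_subdiagram (diagram_C 3) Y (pi_matrix G)) \<and>
         (diagram_of_type (X_long G K) (gcm G) (diagram_A 1) \<longrightarrow>
            \<not> occurs_as_subdiagram (diagram_B 3) Y (pi_matrix G)) \<and>
         (diagram_of_type (X_short G K) (gcm G) (diagram_A 2) \<longrightarrow>
            \<not> occurs_as_subdiagram (diagram_C 5) Y (pi_matrix G) \<and>
            \<not> occurs_as_subdiagram diagram_HD3_2 Y (pi_matrix G)) \<and>
         (diagram_of_type (X_long G K) (gcm G) (diagram_A 2) \<longrightarrow>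
            \<not> occurs_as_subdiagram (diagram_B 5) Y (pi_matrix G) \<and>
            \<not> occurs_as_subdiagram diagram_HC2_1 Y (pi_matrix G))"
proof -
  obtain \<epsilon> where "\<forall>x. Vector_Spaces.linear (scale_g G) (*) (K x)" "\<forall>x y. K x y = K y x"
    "symmetrized_by (gcm G) \<epsilon>"
    "\<forall>i h. K (cartan G (simple_coroot G i)) (cartan G h) = of_rat (\<epsilon> i) * simple_root G i h"
    using assms(4) unfolding standard_invariant_form_def by (elim conjE exE) (rule that)
  then interpret kac_moody_form G K \<epsilon>
    by (intro kac_moody_form.intro kac_moody_form_axioms.intro assms(1)) simp_all
  obtain e where e: "e > 0" "\<And>i. \<epsilon> i = (if i \<in> X_short G K then 2 * e else e)"
    and long: "X_long G K = - X_short G K"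
    using two_weights[OF assms(3,5)] by blast
  have Y: "Y \<subseteq> real_roots G" using assms(6) by (simp add: pi_system_def)
  interpret short: short_class "gcm G" \<epsilon> "X_short G K" e
    using gcm_diag sym e by unfold_locales auto
  \<comment> \<open>Reciprocals exchange the classes: long roots get \<open>1 / e\<close>, twice the
    \<open>1 / (2 * e)\<close> of short ones, so they take the place of \<open>S\<close> for the
    transposed matrix.\<close>
  interpret long: short_class "dual_gcm (gcm G)" "\<lambda>i. 1 / \<epsilon> i" "X_long G K" "1 / (2 * e)"
    using gcm_diag symmetrized_by_dual[OF sym] e by unfold_locales (auto simp: dual_gcm_def long)
  \<comment> \<open>Folding with these equations brings occurrences of \<open>B_n\<close> and
    \<open>HC_2^(1)\<close> into the form that \<open>realizes_flip\<close> expects.\<close>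
  have flips: "map flip_bond (diagram_C n) = diagram_B n" "map flip_bond diagram_HD3_2 = diagram_HC2_1" for n
    by (simp_all add: diagram_B_def diagram_C_def diagram_HD3_2_def diagram_HC2_1_def)
  show ?thesis
  proof (intro conjI impI notI)
    assume D: "diagram_of_type (X_short G K) (gcm G) (diagram_A 1)"
      and C: "occurs_as_subdiagram (diagram_C 3) Y (pi_matrix G)"
    from D obtain p where p: "X_short G K = {p}" by (rule diagram_A1_singleton)
    show False
      using subdiagram_coords[OF Y C] short.no_C3[OF p] by metis
  next
    assume D: "diagram_of_type (X_long G K) (gcm G) (diagram_A 1)"
      and C: "occurs_as_subdiagram (diagram_B 3) Y (pi_matrix G)"
    from D obtain p where p: "X_long G K = {p}" by (rule diagram_A1_singleton)
    show False
      using subdiagram_coords[OF Y C[folded flips]] realizes_flip long.no_C3[OF p] by metis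
  next
    assume D: "diagram_of_type (X_short G K) (gcm G) (diagram_A 2)"
      and C: "occurs_as_subdiagram (diagram_C 5) Y (pi_matrix G)"
    from D obtain p q where p: "X_short G K = {p, q}" "p \<noteq> q" "gcm G p q = -1" "gcm G q p = -1"
      by (rule diagram_A2_pair)
    show False
      using subdiagram_coords[OF Y C] short.no_C5[OF p] by metis
  next
    assume D: "diagram_of_type (X_short G K) (gcm G) (diagram_A 2)"
      and C: "occurs_as_subdiagram diagram_HD3_2 Y (pi_matrix G)"
    from D obtain p q where p: "X_short G K = {p, q}" "p \<noteq> q" "gcm G p q = -1" "gcm G q p = -1"
      by (rule diagram_A2_pair)
    show False
      using subdiagram_coords[OF Y C] short.no_HD3_2[OF p] by metis
  next
    assume D: "diagram_of_type (X_long G K) (gcm G) (diagram_A 2)"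
      and C: "occurs_as_subdiagram (diagram_B 5) Y (pi_matrix G)"
    \<comment> \<open>The matrix of type \<open>A_2\<close> is symmetric, so the type passes to the
      transposed matrix.\<close>
    from D obtain p q where p: "X_long G K = {p, q}" "p \<noteq> q" "dual_gcm (gcm G) p q = -1" "dual_gcm (gcm G) q p = -1"
      unfolding dual_gcm_def by (rule diagram_A2_pair)
    show False
      using subdiagram_coords[OF Y C[folded flips]] realizes_flip long.no_C5[OF p] by metis
  next
    assume D: "diagram_of_type (X_long G K) (gcm G) (diagram_A 2)"
      and C: "occurs_as_subdiagram diagram_HC2_1 Y (pi_matrix G)"
    from D obtain p q where p: "X_long G K = {p, q}" "p \<noteq> q" "dual_gcm (gcm G) p q = -1" "dual_gcm (gcm G) q p = -1"
      unfolding dual_gcm_def by (rule diagram_A2_pair)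
    show False
      using subdiagram_coords[OF Y C[folded flips]] realizes_flip long.no_HD3_2[OF p] by metis
  qed
qed

end
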